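(* For every $t\ge0$ the max-price $q^\gamma_t$ of the discrete model satisfies $$\left|\,q^\gamma_t-\mathsf{b}[q^\gamma_t-t,q^\gamma_t+t]-\frac{2p-F((q^\gamma_t-t)^-)-F(q^\gamma_t+t)}{F(q^\gamma_t+t)-F((q^\gamma_t-t)^-)}\cdot t\,\right|\le 2\gamma,$$ $$\bigl|\mathcal{G}_t(q^\gamma_t)-2pt\bigr|\le 2\gamma .$$
   Context: Let $n\in\mathbb{N}$, let $\gamma$ be the inverse of a natural number, $I^\gamma=[0,1]\cap\gamma\mathbb{N}$ (with $0\in I^\gamma$), and let $B=[b_1,\dots,b_n]$ be a multi-set of $n$ elements of $I^\gamma$. Let $p\in[0,1]$ with $np\in\mathbb{N}$, $np\geq 1$. For a multi-set $A$ of $n$ reals let $b'_1(A)\le\dots\le b'_n(A)$ be its ordered elements and $q(A)=b'_{np}(A)$. One step of the discrete dynamics is $$T^\gamma A=\bigl[\,b'_i(A)+\gamma(\mathbf{1}\{0<i\le np\}-\mathbf{1}\{np<i\le n\}):\ i=1,\dots,n\,\bigr],$$ and $T^\gamma_tB=(T^\gamma)^{\lfloor t/\gamma\rfloor}B$, $q^\gamma_t=q(T^\gamma_tB)$ (no boundary truncation is present in this definition). Associated with the initial multi-set $B$, for $x\in\mathbb{R}$, put $$F(x)=\frac1n\sum_{i=1}^n\mathbf{1}\{b_i\le x\},\qquad \mathcal{G}_t(x)=\int_{x-t}^{x+t}F(z)\,dz,\qquad \mathsf{b}[\alpha,\beta]=\frac{\sum_{i=1}^n b_i\mathbf{1}\{b_i\in[\alpha,\beta]\}}{\sum_{i=1}^n\mathbf{1}\{b_i\in[\alpha,\beta]\}},$$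 and $F(x^-)$ is the left limit of $F$ at $x$. *)

theory Defs
  imports "HOL-Analysis.Analysis" "HOL-Library.Multiset"
begin

definition grid :: "real \<Rightarrow> real set" where
  "grid \<gamma> = {0..1} \<inter> {\<gamma> * real k | k :: nat. True}"

(* The i-th smallest element counted from 1; meaningful for 1 \<le> i \<le> size A. *)
definition ordered_elem :: "real multiset \<Rightarrow> nat \<Rightarrow> real" where
  "ordered_elem A i = sorted_list_of_multiset A ! (i - 1)"

(* The number n of the text is the size of the multiset. The floor is only a conversion
   to nat: n p is assumed to be a natural number wherever this is used. *)
definition max_price :: "real \<Rightarrow> real multiset \<Rightarrow> real" where
  "max_price p A = ordered_elem A (nat \<lfloor>real (size A) * p\<rfloor>)"

definition discrete_step :: "real \<Rightarrow> real \<Rightarrow> real multiset \<Rightarrow> real multiset" where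
  "discrete_step \<gamma> p A =
     image_mset
       (\<lambda>i. ordered_elem A i
          + \<gamma> * (of_bool (0 < i \<and> real i \<le> real (size A) * p)
                - of_bool (real (size A) * p < real i \<and> i \<le> size A)))
       (mset_set {1..size A})"

definition discrete_evolution ::
  "real \<Rightarrow> real \<Rightarrow> real \<Rightarrow> real multiset \<Rightarrow> real multiset" where
  "discrete_evolution \<gamma> p t B = (discrete_step \<gamma> p ^^ nat \<lfloor>t / \<gamma>\<rfloor>) B"

definition discrete_max_price :: "real \<Rightarrow> real \<Rightarrow> real multiset \<Rightarrow> real \<Rightarrow> real" where
  "discrete_max_price \<gamma> p B t = max_price p (discrete_evolution \<gamma> p t B)"

definition distr_fun :: "real multiset \<Rightarrow> real \<Rightarrow> real" where
  "distr_fun B x = real (size (filter_mset (\<lambda>b. b \<le> x) B)) / real (size B)"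

definition left_limit :: "(real \<Rightarrow> real) \<Rightarrow> real \<Rightarrow> real" where
  "left_limit f x = Lim (at_left x) f"

definition window_integral :: "real multiset \<Rightarrow> real \<Rightarrow> real \<Rightarrow> real" where
  "window_integral B t x = integral {x - t..x + t} (distr_fun B)"

definition window_mean :: "real multiset \<Rightarrow> real \<Rightarrow> real \<Rightarrow> real" where
  "window_mean B \<alpha> \<beta> =
     sum_mset (filter_mset (\<lambda>b. b \<in> {\<alpha>..\<beta>}) B)
       / real (size (filter_mset (\<lambda>b. b \<in> {\<alpha>..\<beta>}) B))"

end

theory Submission
  imports Defs "HOL-Combinatorics.Permutations"
begin

text \<open>
  Label the particles, so that at each step \<open>k = n p\<close> of them move up by \<open>\<gamma>\<close> and the others down,
  with particles strictly below (above) \<open>q\<close> always moving up (down). Since \<open>q\<close> moves by at most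
  \<open>\<gamma>\<close> per step, a particle that starts outside \<open>[q\<^sub>t - t, q\<^sub>t + t]\<close> moves towards \<open>q\<close> at full speed
  until time \<open>t\<close>, while one that starts inside ends within \<open>2 \<gamma>\<close> of \<open>q\<^sub>t\<close>. The sum of all positions
  grows by \<open>\<gamma> (2 k - n)\<close> per step. Cancelling the outside particles from this balance turns both
  quantities to be estimated into a sum of displacements from \<open>q\<^sub>t\<close> over the particles of the
  window, divided by their number or by \<open>n\<close>; this covers multiples of \<open>\<gamma>\<close>, and for the other times
  the sides of \<open>q\<^sub>t\<close> on which these particles lie must be counted as well.
\<close>

section \<open>One step of the dynamics on labelled particles\<close>

text \<open>A permutation sorting the positions turns ranks into labels, which can be followed
  through time. Ties at the price are split as the sorted order happens to place them, so
  \<open>U\<close> is only claimed to exist.\<close>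

lemma discrete_step_labelled:
  fixes f :: "nat \<Rightarrow> real"
  assumes A: "A = image_mset f (mset_set {..<n})"
    and k: "1 \<le> k" "k \<le> n" "real k = real n * p"
  obtains U where "U \<subseteq> {..<n}" "card U = k"
    "\<And>i. i \<in> U \<Longrightarrow> f i \<le> max_price p A"
    "\<And>i. i < n \<Longrightarrow> i \<notin> U \<Longrightarrow> max_price p A \<le> f i"
    "card {i. i < n \<and> f i < max_price p A} < k"
    "max_price p A \<in> f ` {..<n}"
    "discrete_step \<gamma> p A =
       image_mset (\<lambda>i. f i + (if i \<in> U then \<gamma> else - \<gamma>)) (mset_set {..<n})"
proof -
  define xs where "xs = sorted_list_of_multiset A"
  have "mset xs = mset (map f [0..<n])"
    by (simp add: xs_def A atLeast0LessThan)
  then obtain \<pi> where \<pi>: "\<pi> permutes {..<n}" and perm: "permute_list \<pi> (map f [0..<n]) = xs"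
    by (metis diff_zero length_map length_upt mset_eq_permutation)
  have sz: "size A = n" and len: "length xs = n"
    using perm by (auto simp: A)
  have \<pi>_less: "\<pi> j < n \<longleftrightarrow> j < n" for j
    using permutes_in_image[OF \<pi>] by simp
  have xs_nth: "xs ! j = f (\<pi> j)" if "j < n" for j
    using permute_list_nth[of \<pi> "map f [0..<n]" j] \<pi> that by (simp add: perm \<pi>_less)
  have sorted: "sorted xs"
    by (simp add: xs_def)
  have inj: "inj \<pi>"
    using \<pi> by (rule permutes_inj)
  have q: "max_price p A = xs ! (k - 1)"
    by (simp add: max_price_def ordered_elem_def sz xs_def flip: k(3))
  define U where "U = \<pi> ` {..<k}"
  have onto: "\<exists>j<n. i = \<pi> j" if "i < n" for i
  proof -
    have "i \<in> \<pi> ` {..<n}" using that by (simp add: permutes_image[OF \<pi>])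
    then show ?thesis by auto
  qed
  show ?thesis
  proof (rule that[of U])
    show "U \<subseteq> {..<n}"
      using k(2) by (auto simp: U_def \<pi>_less)
    show "card U = k"
      by (simp add: U_def card_image inj_on_subset[OF inj])
    show "f i \<le> max_price p A" if i: "i \<in> U" for i
    proof -
      obtain j where j: "j < k" "i = \<pi> j" using i by (auto simp: U_def)
      have "xs ! j \<le> xs ! (k - 1)"
        by (rule sorted_nth_mono[OF sorted]) (use j k len in auto)
      with j k show ?thesis by (simp add: q xs_nth)
    qed
    show "max_price p A \<le> f i" if i: "i < n" "i \<notin> U" for i
    proof -
      obtain j where j: "j < n" "i = \<pi> j" using onto i by blast
      with i have "\<not> j < k" by (auto simp: U_def)
      with j len have "xs ! (k - 1) \<le> xs ! j"
        by (intro sorted_nth_mono[OF sorted]) auto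
      with j show ?thesis by (simp add: q xs_nth)
    qed
    \<comment> \<open>List indices start at 0, so the price sits at index \<open>k - 1\<close>, and
      a value strictly below it must come earlier.\<close>
    have "{i. i < n \<and> f i < max_price p A} \<subseteq> \<pi> ` {..<k - 1}"
    proof clarsimp
      fix i assume i: "i < n" "f i < max_price p A"
      obtain j where j: "j < n" "i = \<pi> j" using onto i by blast
      have "j < k - 1"
      proof (rule ccontr)
        assume "\<not> j < k - 1"
        with j len have "xs ! (k - 1) \<le> xs ! j"
          by (intro sorted_nth_mono[OF sorted]) auto
        with i j show False by (simp add: q xs_nth)
      qed
      with j show "i \<in> \<pi> ` {..<k - Suc 0}" by auto
    qed
    then have "card {i. i < n \<and> f i < max_price p A} \<le> card (\<pi> ` {..<k - 1})"
      by (intro card_mono) auto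
    also have "\<dots> \<le> k - 1"
      using card_image_le[of "{..<k - 1}" \<pi>] by simp
    finally show "card {i. i < n \<and> f i < max_price p A} < k"
      using k by simp
    show "max_price p A \<in> f ` {..<n}"
    proof -
      have "k - 1 < n" using k(1,2) by simp
      then have "f (\<pi> (k - 1)) \<in> f ` {..<n}" by (simp add: \<pi>_less)
      with \<open>k - 1 < n\<close> show ?thesis by (simp add: q xs_nth)
    qed
    have iU: "\<pi> j \<in> U \<longleftrightarrow> j < k" for j
      using inj by (auto simp: U_def inj_eq)
    have "discrete_step \<gamma> p A = image_mset (\<lambda>i. xs ! (i - 1) + (if i \<le> k then \<gamma> else - \<gamma>))
        (mset_set {1..n})"
      unfolding discrete_step_def sz k(3)[symmetric]
      by (intro image_mset_cong) (auto simp: ordered_elem_def xs_def)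
    also have "mset_set {1..n} = image_mset Suc (mset_set {..<n})"
      by (subst image_mset_mset_set) (auto simp: image_Suc_lessThan)
    also have "image_mset (\<lambda>i. xs ! (i - 1) + (if i \<le> k then \<gamma> else - \<gamma>)) \<dots>
        = image_mset (\<lambda>i. f i + (if i \<in> U then \<gamma> else - \<gamma>)) (image_mset \<pi> (mset_set {..<n}))"
      unfolding multiset.map_comp
      by (intro image_mset_cong) (auto simp: xs_nth iU)
    \<comment> \<open>Since \<open>\<pi>\<close> permutes the labels, the sorted order can be
      forgotten again.\<close>
    also have "image_mset \<pi> (mset_set {..<n}) = mset_set {..<n}"
      using permutes_image[OF \<pi>] by (simp add: image_mset_mset_set inj_on_subset[OF inj])
    finally show "discrete_step \<gamma> p A =
        image_mset (\<lambda>i. f i + (if i \<in> U then \<gamma> else - \<gamma>)) (mset_set {..<n})" .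
  qed
qed

section \<open>Price and particles along a labelled trajectory\<close>

text \<open>\<open>U s\<close> holds the labels that rise at step \<open>s\<close>. Ties at
  \<open>q s\<close> may be split in any way, so the price is pinned down by
  \<open>card_less\<close> and \<open>q_mem\<close> rather than by sorting.\<close>

locale price_trajectory =
  fixes n k :: nat and \<gamma> :: real and X :: "nat \<Rightarrow> nat \<Rightarrow> real"
    and U :: "nat \<Rightarrow> nat set" and q :: "nat \<Rightarrow> real"
  assumes \<gamma>_pos: "\<gamma> > 0"
    and U_subset: "U s \<subseteq> {..<n}"
    and card_U: "card (U s) = k"
    and X_Suc: "i < n \<Longrightarrow> X (Suc s) i = X s i + (if i \<in> U s then \<gamma> else - \<gamma>)"
    and U_le: "i \<in> U s \<Longrightarrow> X s i \<le> q s"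
    and not_U_ge: "i < n \<Longrightarrow> i \<notin> U s \<Longrightarrow> q s \<le> X s i"
    and card_less: "card {i. i < n \<and> X s i < q s} < k"
    and q_mem: "q s \<in> X s ` {..<n}"
    and lattice: "i < n \<Longrightarrow> \<exists>z::int. X 0 i = \<gamma> * of_int z"
begin

text \<open>The \<open>k\<close> rising particles end at or below \<open>q s + \<gamma>\<close>. A
  higher new price would have all of them strictly below it, against
  \<open>card_less\<close>.\<close>

lemma q_Suc_le: "q (Suc s) \<le> q s + \<gamma>"
proof (rule ccontr)
  assume "\<not> ?thesis"
  then have "U s \<subseteq> {i. i < n \<and> X (Suc s) i < q (Suc s)}"
    using U_subset[of s] U_le[of _ s] by (fastforce simp: X_Suc subset_iff)
  then have "k \<le> card {i. i < n \<and> X (Suc s) i < q (Suc s)}"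
    unfolding card_U[of s, symmetric] by (intro card_mono) auto
  with card_less[of "Suc s"] show False by simp
qed

text \<open>Particles in \<open>U (Suc s)\<close> are at or below the new price. If it had dropped
  by more than \<open>\<gamma>\<close>, these \<open>k\<close> particles would all have been
  strictly below \<open>q s\<close>.\<close>

lemma q_Suc_ge: "q s - \<gamma> \<le> q (Suc s)"
proof (rule ccontr)
  assume *: "\<not> ?thesis"
  have "U (Suc s) \<subseteq> {i. i < n \<and> X s i < q s}"
  proof
    fix i assume i: "i \<in> U (Suc s)"
    with U_subset have "i < n" by auto
    with U_le[OF i] * \<gamma>_pos show "i \<in> {i. i < n \<and> X s i < q s}"
      by (auto simp: X_Suc split: if_splits)
  qed
  then have "k \<le> card {i. i < n \<and> X s i < q s}"
    unfolding card_U[of "Suc s", symmetric] by (intro card_mono) auto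
  with card_less[of s] show False by simp
qed

text \<open>The price rises no faster than a particle moving up freely, so the hypothesis at time
  \<open>s\<close> implies the same at all earlier times. The particle was thus always below the
  price and had to rise.\<close>

lemma rising:
  assumes "i < n" "X 0 i + real s * \<gamma> < q s"
  shows "X s i = X 0 i + real s * \<gamma>"
  using assms(2)
proof (induction s)
  case (Suc s)
  then have *: "X 0 i + real s * \<gamma> < q s"
    using q_Suc_le[of s] by (simp add: algebra_simps)
  with Suc.IH have "X s i < q s" by simp
  with not_U_ge[OF assms(1)] have "i \<in> U s" by force
  with Suc.IH * assms(1) show ?case by (simp add: X_Suc algebra_simps)
qed simp

lemma falling:
  assumes "i < n" "q s < X 0 i - real s * \<gamma>"
  shows "X s i = X 0 i - real s * \<gamma>"
  using assms(2)
proof (induction s)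
  case (Suc s)
  then have *: "q s < X 0 i - real s * \<gamma>"
    using q_Suc_ge[of s] by (simp add: algebra_simps)
  with Suc.IH have "q s < X s i" by simp
  with U_le[of i s] have "i \<notin> U s" by force
  with Suc.IH * assms(1) show ?case by (simp add: X_Suc algebra_simps)
qed simp

text \<open>A particle stepping down was at or above the price and lands at most
  \<open>\<gamma>\<close> below the old one; the price itself may rise by another
  \<open>\<gamma>\<close>. Later upward steps keep pace with the price.\<close>

lemma lower_barrier:
  assumes "i < n"
  shows "X s i = X 0 i + real s * \<gamma> \<or> q s - 2 * \<gamma> \<le> X s i"
proof (induction s)
  case (Suc s)
  then show ?case
    using assms q_Suc_le[of s] not_U_ge[OF assms, of s]
    by (auto simp: X_Suc algebra_simps)
qed simp

lemma upper_barrier: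
  assumes "i < n"
  shows "X s i = X 0 i - real s * \<gamma> \<or> X s i \<le> q s + 2 * \<gamma>"
proof (induction s)
  case (Suc s)
  then show ?case
    using assms q_Suc_ge[of s] U_le[of i s]
    by (auto simp: X_Suc algebra_simps)
qed simp

lemma sum_X: "(\<Sum>i<n. X s i) = (\<Sum>i<n. X 0 i) + real s * \<gamma> * (2 * real k - real n)"
proof (induction s)
  case (Suc s)
  have "(\<Sum>i<n. if i \<in> U s then \<gamma> else - \<gamma>) = (\<Sum>i<n. (if i \<in> U s then 2 * \<gamma> else 0) - \<gamma>)"
    by (intro sum.cong) auto
  also have "\<dots> = 2 * \<gamma> * real k - real n * \<gamma>"
    using U_subset[of s] card_U[of s]
    by (simp add: sum_subtractf sum.If_cases Int_absorb1)
  finally show ?case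
    using Suc by (simp add: X_Suc sum.distrib algebra_simps)
qed simp

lemma X_lattice: "i < n \<Longrightarrow> \<exists>z::int. X s i = \<gamma> * of_int z"
proof (induction s)
  case (Suc s)
  then obtain z :: int where "X s i = \<gamma> * of_int z" by blast
  with Suc.prems have "X (Suc s) i = \<gamma> * of_int (z + (if i \<in> U s then 1 else - 1))"
    by (simp add: X_Suc algebra_simps)
  then show ?case by blast
qed (simp add: lattice)

lemma q_diff_lattice:
  assumes "i < n"
  shows "\<exists>z::int. q s - X 0 i = \<gamma> * of_int z"
proof -
  obtain j where "j < n" "q s = X s j" using q_mem[of s] by auto
  then obtain a where "q s = \<gamma> * of_int a" using X_lattice[of j s] by auto
  moreover obtain b where "X 0 i = \<gamma> * of_int b" using lattice[OF assms] by auto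
  ultimately have "q s - X 0 i = \<gamma> * of_int (a - b)" by (simp add: algebra_simps)
  then show ?thesis by blast
qed

text \<open>No multiple of \<open>\<gamma>\<close> lies above \<open>real s * \<gamma>\<close> and
  at or below \<open>t\<close>.\<close>

lemma lattice_window:
  assumes "real s * \<gamma> \<le> t" "t < real (Suc s) * \<gamma>" "y = \<gamma> * of_int z"
  shows "y \<le> t \<longleftrightarrow> y \<le> real s * \<gamma>"
proof
  assume "y \<le> t"
  with assms have "\<gamma> * of_int z < \<gamma> * real (Suc s)" by (simp add: mult.commute)
  then have "real_of_int z < real (Suc s)" using \<gamma>_pos by simp
  then have "z \<le> int s" by linarith
  then have "real_of_int z \<le> real s" by linarith
  then show "y \<le> real s * \<gamma>" using assms(3) \<gamma>_pos by (simp add: mult.commute)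
qed (use assms in simp)

text \<open>The expression in bars is the common numerator of both deviations: divided by
  \<open>real (card M)\<close> it gives the one with the window mean, divided by
  \<open>real n\<close> the one with the integral.\<close>

lemma window_bound:
  fixes t :: real
  assumes t: "real s * \<gamma> \<le> t" "t < real (Suc s) * \<gamma>"
  defines "L \<equiv> {i. i < n \<and> X 0 i < q s - t}"
    and "M \<equiv> {i. i < n \<and> X 0 i \<in> {q s - t..q s + t}}"
  shows "card M > 0"
    and "\<bar>(\<Sum>i\<in>M. q s - X 0 i) + t * (2 * real (card L) + real (card M) - 2 * real k)\<bar>
           \<le> 2 * \<gamma> * real (card M)"
proof -
  define R where "R = {i. i < n \<and> q s + t < X 0 i}"
  \<comment> \<open>As positions lie on the lattice, the window for \<open>t\<close> catches the same particles as the one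
    for \<open>T\<close>.\<close>
  define T where "T = real s * \<gamma>"
  have L: "i \<in> L \<longleftrightarrow> i < n \<and> X 0 i + T < q s" for i
  proof (cases "i < n")
    case True
    then obtain z :: int where "q s - X 0 i = \<gamma> * of_int z" using q_diff_lattice by blast
    from lattice_window[OF t this] True show ?thesis
      by (auto simp: L_def T_def)
  qed (simp add: L_def)
  have R: "i \<in> R \<longleftrightarrow> i < n \<and> q s < X 0 i - T" for i
  proof (cases "i < n")
    case True
    then obtain z :: int where "q s - X 0 i = \<gamma> * of_int z" using q_diff_lattice by blast
    then have "X 0 i - q s = \<gamma> * of_int (- z)" by simp
    from lattice_window[OF t this] True show ?thesis
      by (auto simp: R_def T_def)
  qed (simp add: R_def)
  have "0 \<le> real s * \<gamma>" using \<gamma>_pos by simp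
  with t(1) have t0: "0 \<le> t" by linarith
  have part: "{..<n} = L \<union> M \<union> R" "(L \<union> M) \<inter> R = {}" "L \<inter> M = {}"
    using t0 by (auto simp: L_def M_def R_def)
  have fin: "finite L" "finite M" "finite R"
    by (auto simp: L_def M_def R_def)
  have split: "sum g {..<n} = sum g L + sum g M + sum g R" for g :: "nat \<Rightarrow> real"
    unfolding part(1) using part fin by (simp add: sum.union_disjoint)
  have n: "real n = real (card L) + real (card M) + real (card R)"
    using split[of "\<lambda>_. 1"] by simp
  have XL: "X s i = X 0 i + T" if "i \<in> L" for i
    using that rising[of i s] by (simp add: L T_def)
  have XR: "X s i = X 0 i - T" if "i \<in> R" for i
    using that falling[of i s] by (simp add: R T_def)
  \<comment> \<open>If the first alternative of a barrier lemma holds, membership outside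
    \<open>L\<close> or \<open>R\<close> already places the particle on the required side of
    \<open>q s\<close>.\<close>
  have XM: "q s - 2 * \<gamma> \<le> X s i" "X s i \<le> q s + 2 * \<gamma>" if "i \<in> M" for i
  proof -
    have i: "i < n" "i \<notin> L" "i \<notin> R"
      using that part by (auto simp: M_def)
    with lower_barrier[of i s] upper_barrier[of i s] \<gamma>_pos
    show "q s - 2 * \<gamma> \<le> X s i" "X s i \<le> q s + 2 * \<gamma>"
      by (auto simp: L R T_def)
  qed
  define D where "D = (\<Sum>i\<in>M. q s - X s i)"
  \<comment> \<open>This is the balance \<open>sum_X\<close> after removing the displacements
    \<open>T\<close> on \<open>L\<close> and \<open>- T\<close> on \<open>R\<close>, with
    \<open>card R\<close> eliminated through \<open>n\<close>.\<close>
  have D: "(\<Sum>i\<in>M. q s - X 0 i) + T * (2 * real (card L) + real (card M) - 2 * real k) = D"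
    using sum_X[of s] XL XR
    by (simp add: split D_def sum_subtractf sum.distrib n T_def algebra_simps)
  \<comment> \<open>At time \<open>s\<close>, fewer than \<open>a\<close> window particles lie below \<open>q s\<close> and at most \<open>b\<close> above it. The
    remainder \<open>r\<close> of \<open>t\<close> contributes \<open>r * (b - a)\<close>, whose excess on either side is absorbed by the
    one-sided bounds \<open>- 2 * \<gamma> * b \<le> D \<le> 2 * \<gamma> * a\<close>.\<close>
  define a where "a = real k - real (card L)"
  define b where "b = real (card M) - a"
  define lo where "lo = {i \<in> M. X s i < q s}"
  define hi where "hi = {i \<in> M. q s < X s i}"
  have finlh: "finite lo" "finite hi" "lo \<subseteq> M" "hi \<subseteq> M"
    using fin by (auto simp: lo_def hi_def)
  have "card (L \<union> lo) \<le> card {i. i < n \<and> X s i < q s}"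
  proof (intro card_mono subsetI)
    fix i assume "i \<in> L \<union> lo"
    then show "i \<in> {i. i < n \<and> X s i < q s}"
      using XL[of i] L[of i] by (auto simp: lo_def M_def)
  qed auto
  moreover have "card (L \<union> lo) = card L + card lo"
    using part fin finlh by (intro card_Un_disjoint) auto
  \<comment> \<open>The strict inequality in \<open>card_less\<close> supplies the \<open>1\<close>,
    which later makes the window nonempty.\<close>
  ultimately have lo: "real (card lo) + 1 \<le> a"
    using card_less[of s] by (simp add: a_def)
  have "card (hi \<union> R) \<le> card ({..<n} - U s)"
  proof (intro card_mono subsetI)
    fix i assume "i \<in> hi \<union> R"
    then have "i < n" "q s < X s i"
      using XR[of i] R[of i] by (auto simp: hi_def M_def)
    with U_le[of i s] show "i \<in> {..<n} - U s" by force
  qed auto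
  moreover have "card (hi \<union> R) = card hi + card R"
    using part fin finlh by (intro card_Un_disjoint) auto
  moreover have "card ({..<n} - U s) + k = n"
    using card_mono[OF _ U_subset[of s]] U_subset[of s] card_U[of s]
    by (simp add: card_Diff_subset finite_subset)
  ultimately have hi: "real (card hi) \<le> b"
    using n by (simp add: a_def b_def)
  have ab: "1 \<le> a" "0 \<le> b" using lo hi by auto
  then show "card M > 0" by (simp add: b_def)
  \<comment> \<open>Only particles below the price contribute positively, each at most
    \<open>2 * \<gamma>\<close>.\<close>
  have "D \<le> (\<Sum>i\<in>M. if i \<in> lo then 2 * \<gamma> else 0)"
    unfolding D_def
  proof (rule sum_mono)
    fix i assume "i \<in> M"
    with XM[OF this] show "q s - X s i \<le> (if i \<in> lo then 2 * \<gamma> else 0)"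
      by (auto simp: lo_def)
  qed
  also have "\<dots> = 2 * \<gamma> * card lo"
    using fin finlh by (simp add: sum.If_cases Int_absorb1)
  also have "\<dots> \<le> 2 * \<gamma> * a" using lo \<gamma>_pos by simp
  finally have D_le: "D \<le> 2 * \<gamma> * a" .
  have "2 * \<gamma> * (- b) \<le> 2 * \<gamma> * (- real (card hi))"
    using hi \<gamma>_pos by simp
  also have "\<dots> = (\<Sum>i\<in>M. if i \<in> hi then - 2 * \<gamma> else 0)"
    using fin finlh by (simp add: sum.If_cases Int_absorb1)
  also have "\<dots> \<le> D"
    unfolding D_def
  proof (rule sum_mono)
    fix i assume "i \<in> M"
    with XM[OF this] show "(if i \<in> hi then - 2 * \<gamma> else 0) \<le> q s - X s i"
      by (auto simp: hi_def)
  qed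
  finally have D_ge: "- (2 * \<gamma> * b) \<le> D" by simp
  define r where "r = t - T"
  have r: "0 \<le> r" "r \<le> \<gamma>"
    using t by (auto simp: r_def T_def algebra_simps)
  have "(\<Sum>i\<in>M. q s - X 0 i) + t * (2 * real (card L) + real (card M) - 2 * real k)
      = D + r * (b - a)"
    unfolding D[symmetric] by (simp add: r_def a_def b_def algebra_simps)
  moreover have "real (card M) = a + b" by (simp add: b_def)
  moreover have "0 \<le> r * a" "r * a \<le> \<gamma> * a" "0 \<le> r * b" "r * b \<le> \<gamma> * b"
    using r ab by (auto intro: mult_right_mono)
  ultimately show "\<bar>(\<Sum>i\<in>M. q s - X 0 i)
      + t * (2 * real (card L) + real (card M) - 2 * real k)\<bar> \<le> 2 * \<gamma> * real (card M)"
    using D_le D_ge by (simp add: algebra_simps abs_le_iff)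
qed

end

section \<open>Constructing a labelled trajectory\<close>

text \<open>Each step is labelled relative to the previous one, so the trajectory comes from
  dependent choice.\<close>

lemma trajectory_exists:
  fixes f :: "nat \<Rightarrow> real"
  assumes B: "B = image_mset f (mset_set {..<n})"
    and k: "1 \<le> k" "k \<le> n" "real k = real n * p"
    and \<gamma>: "\<gamma> > 0"
    and lattice: "\<And>i. i < n \<Longrightarrow> \<exists>z::int. f i = \<gamma> * of_int z"
  obtains X U where "X 0 = f"
    "price_trajectory n k \<gamma> X U (\<lambda>s. max_price p ((discrete_step \<gamma> p ^^ s) B))"
proof -
  define A where "A s = (discrete_step \<gamma> p ^^ s) B" for s
  \<comment> \<open>The clause for \<open>s = 0\<close> fixes the start, since dependent choice only
    guarantees that the first value satisfies \<open>P 0\<close>.\<close>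
  define P where "P s x \<longleftrightarrow> A s = image_mset x (mset_set {..<n}) \<and> (s = 0 \<longrightarrow> x = f)"
    for s and x :: "nat \<Rightarrow> real"
  define Q where "Q s x y V \<longleftrightarrow> V \<subseteq> {..<n} \<and> card V = k
      \<and> (\<forall>i\<in>V. x i \<le> max_price p (A s)) \<and> (\<forall>i<n. i \<notin> V \<longrightarrow> max_price p (A s) \<le> x i)
      \<and> card {i. i < n \<and> x i < max_price p (A s)} < k \<and> max_price p (A s) \<in> x ` {..<n}
      \<and> y = (\<lambda>i. x i + (if i \<in> V then \<gamma> else - \<gamma>))"
    for s and x y :: "nat \<Rightarrow> real" and V
  have "\<exists>X. \<forall>s. P s (X s) \<and> (\<exists>V. Q s (X s) (X (Suc s)) V)"
  proof (rule dependent_nat_choice)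
    show "\<exists>x. P 0 x" using B by (auto simp: P_def A_def)
    fix x s assume "P s x"
    then have As: "A s = image_mset x (mset_set {..<n})" by (simp add: P_def)
    obtain V where V: "V \<subseteq> {..<n}" "card V = k"
      "\<And>i. i \<in> V \<Longrightarrow> x i \<le> max_price p (A s)"
      "\<And>i. i < n \<Longrightarrow> i \<notin> V \<Longrightarrow> max_price p (A s) \<le> x i"
      "card {i. i < n \<and> x i < max_price p (A s)} < k"
      "max_price p (A s) \<in> x ` {..<n}"
      "discrete_step \<gamma> p (A s)
        = image_mset (\<lambda>i. x i + (if i \<in> V then \<gamma> else - \<gamma>)) (mset_set {..<n})"
      by (rule discrete_step_labelled[OF As k, of \<gamma>]) (rule that, (assumption | blast)+)
    define y where "y = (\<lambda>i. x i + (if i \<in> V then \<gamma> else - \<gamma>))"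
    have "P (Suc s) y"
      using V(7) by (simp add: P_def A_def y_def)
    moreover have "Q s x y V"
      unfolding Q_def y_def by (intro conjI ballI allI impI refl V)
    ultimately show "\<exists>y. P (Suc s) y \<and> (\<exists>V. Q s x y V)" by blast
  qed
  then obtain X where P: "\<And>s. P s (X s)" and "\<forall>s. \<exists>V. Q s (X s) (X (Suc s)) V"
    by blast
  from choice[OF this(2)] obtain U where Q: "\<And>s. Q s (X s) (X (Suc s)) (U s)"
    by blast
  have X0: "X 0 = f" using P[of 0] by (simp add: P_def)
  note Q' = Q[unfolded Q_def]
  have "price_trajectory n k \<gamma> X U (\<lambda>s. max_price p (A s))"
  proof
    fix s i
    show "\<gamma> > 0" by (rule \<gamma>)
    show "U s \<subseteq> {..<n}" "card (U s) = k"
      "card {i. i < n \<and> X s i < max_price p (A s)} < k" "max_price p (A s) \<in> X s ` {..<n}"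
      by (simp_all only: Q')
    show "X (Suc s) i = X s i + (if i \<in> U s then \<gamma> else - \<gamma>)"
      using Q'[of s] by simp
    show "X s i \<le> max_price p (A s)" if "i \<in> U s"
      using Q'[of s] that by simp
    show "max_price p (A s) \<le> X s i" if "i < n" "i \<notin> U s"
      using Q'[of s] that by simp
    show "\<exists>z::int. X 0 i = \<gamma> * of_int z" if "i < n"
      using lattice[OF that] by (simp add: X0)
  qed
  with X0 that show ?thesis by (simp add: A_def)
qed

section \<open>Distribution function and window integral in terms of labels\<close>

lemma distr_fun_labelled:
  "distr_fun (image_mset f (mset_set {..<n})) x = real (card {i. i < n \<and> f i \<le> x}) / real n"
  by (simp only: distr_fun_def filter_mset_image_mset size_image_mset filter_mset_mset_set
      finite_lessThan size_mset_set card_lessThan lessThan_iff)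

text \<open>With finitely many labels, the distribution function is constant on some interval ending
  just before \<open>x\<close>.\<close>

lemma left_limit_distr_fun_labelled:
  "left_limit (distr_fun (image_mset f (mset_set {..<n}))) x
     = real (card {i. i < n \<and> f i < x}) / real n"
proof -
  have "eventually (\<lambda>y. f i \<le> y \<longleftrightarrow> f i < x) (at_left x)" for i
  proof (cases "f i < x")
    case True
    then have "eventually (\<lambda>y. y \<in> {f i<..<x}) (at_left x)"
      by (rule eventually_at_left_real)
    then show ?thesis by eventually_elim auto
  next
    case False
    have "eventually (\<lambda>y. y \<in> {x - 1<..<x}) (at_left x)"
      by (rule eventually_at_left_real) simp
    then show ?thesis by eventually_elim (use False in auto)
  qed
  then have "eventually (\<lambda>y. \<forall>i\<in>{..<n}. f i \<le> y \<longleftrightarrow> f i < x) (at_left x)"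
    by (intro eventually_ball_finite) auto
  then have "eventually (\<lambda>y. distr_fun (image_mset f (mset_set {..<n})) y
      = real (card {i. i < n \<and> f i < x}) / real n) (at_left x)"
  proof eventually_elim
    case (elim y)
    then have "{i. i < n \<and> f i \<le> y} = {i. i < n \<and> f i < x}" by auto
    then show ?case by (simp only: distr_fun_labelled)
  qed
  then have "(distr_fun (image_mset f (mset_set {..<n}))
      \<longlongrightarrow> real (card {i. i < n \<and> f i < x}) / real n) (at_left x)"
    by (rule tendsto_eventually)
  then show ?thesis
    unfolding left_limit_def by (intro tendsto_Lim) auto
qed

lemma has_integral_step:
  fixes \<alpha> \<beta> c :: real
  assumes "\<alpha> \<le> \<beta>"
  shows "((\<lambda>z. of_bool (c \<le> z)) has_integral
    (if c < \<alpha> then \<beta> - \<alpha> else if c \<le> \<beta> then \<beta> - c else 0)) {\<alpha>..\<beta>}"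
proof -
  have "((\<lambda>z. if z \<in> {c..} then 1 else 0) has_integral
      (if c < \<alpha> then \<beta> - \<alpha> else if c \<le> \<beta> then \<beta> - c else 0)) {\<alpha>..\<beta>}"
    unfolding has_integral_restrict_Int
    using has_integral_const_real[of "1::real" "max c \<alpha>" \<beta>] assms
    by (auto simp: max_def Int_atLeastAtMost split: if_splits)
  then show ?thesis by (simp add: of_bool_def)
qed

text \<open>The distribution function averages unit steps at the \<open>f i\<close>. A step before
  the window contributes its full width \<open>2 * t\<close>, one inside contributes
  \<open>x - f i + t\<close>, one beyond it nothing.\<close>

lemma window_integral_labelled:
  fixes f :: "nat \<Rightarrow> real" and n :: nat and t x :: real
  assumes "t \<ge> 0"
  defines "L \<equiv> {i. i < n \<and> f i < x - t}"
    and "M \<equiv> {i. i < n \<and> f i \<in> {x - t..x + t}}"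
  shows "window_integral (image_mset f (mset_set {..<n})) t x
    = ((\<Sum>i\<in>M. x - f i) + t * (2 * real (card L) + real (card M))) / real n"
proof -
  let ?g = "\<lambda>i. if f i < x - t then 2 * t else if f i \<le> x + t then x - f i + t else 0"
  have eq: "distr_fun (image_mset f (mset_set {..<n})) z = (\<Sum>i<n. of_bool (f i \<le> z)) / real n" for z
    by (simp add: distr_fun_labelled sum.If_cases of_bool_def Int_def)
  have "((\<lambda>z. of_bool (f i \<le> z)) has_integral ?g i) {x - t..x + t}" for i
    using has_integral_step[of "x - t" "x + t" "f i"] assms(1)
    by (simp add: algebra_simps cong: if_cong)
  then have "((\<lambda>z. (\<Sum>i<n. of_bool (f i \<le> z)) / real n) has_integral (\<Sum>i<n. ?g i) / real n)
      {x - t..x + t}"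
    by (intro has_integral_divide has_integral_sum) auto
  then have "window_integral (image_mset f (mset_set {..<n})) t x = (\<Sum>i<n. ?g i) / real n"
    unfolding window_integral_def eq by (rule integral_unique)
  moreover have "(\<Sum>i<n. ?g i) = (\<Sum>i<n. (if i \<in> L then 2 * t else 0) + (if i \<in> M then x - f i + t else 0))"
    by (intro sum.cong) (auto simp: L_def M_def)
  moreover have "\<dots> = 2 * t * real (card L) + (\<Sum>i\<in>M. x - f i + t)"
  proof -
    have "{..<n} \<inter> L = L" "{..<n} \<inter> M = M" by (auto simp: L_def M_def)
    then show ?thesis by (simp add: sum.distrib flip: sum.inter_restrict)
  qed
  ultimately show ?thesis
    by (simp add: sum.distrib distrib_left mult.assoc mult.left_commute[of t] add_ac)
qed

section \<open>Assembling the two estimates\<close>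

theorem proposition3p1:
  fixes n m :: nat and \<gamma> p t :: real and B :: "real multiset"
  assumes "m \<ge> 1" and "\<gamma> = 1 / real m"
    and "size B = n" and "set_mset B \<subseteq> grid \<gamma>"
    and "p \<in> {0..1}" and "real n * p \<in> \<nat>" and "real n * p \<ge> 1"
    and "t \<ge> 0"
  shows "let q = discrete_max_price \<gamma> p B t;
             F = distr_fun B
         in \<bar>q - window_mean B (q - t) (q + t)
               - (2 * p - left_limit F (q - t) - F (q + t))
                 / (F (q + t) - left_limit F (q - t)) * t\<bar> \<le> 2 * \<gamma>
            \<and> \<bar>window_integral B t q - 2 * p * t\<bar> \<le> 2 * \<gamma>"
proof -
  have \<gamma>: "\<gamma> > 0" using assms(1,2) by simp
  obtain k where k: "real k = real n * p" using assms(6) by (auto elim: Nats_cases)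
  have k1: "1 \<le> k" using assms(7) k by linarith
  have kn: "k \<le> n"
    using assms(5) k mult_left_le[of p "real n"] by (simp flip: of_nat_le_iff)
  \<comment> \<open>Any listing of \<open>B\<close> serves as the labelling; it need not be
    sorted.\<close>
  obtain xs where xs: "B = mset xs" using ex_mset by metis
  define f where "f = (!) xs"
  have B: "B = image_mset f (mset_set {..<n})"
    using assms(3) map_nth[of xs] unfolding f_def xs
    by (metis atLeast0LessThan mset_map mset_upt size_mset)
  have "\<exists>z::int. f i = \<gamma> * of_int z" if "i < n" for i
  proof -
    have "f i \<in> grid \<gamma>" using that assms(4) by (auto simp: B)
    then obtain j where "f i = \<gamma> * real j" by (auto simp: grid_def)
    then show ?thesis by (intro exI[of _ "int j"]) simp
  qed
  from trajectory_exists[OF B k1 kn k \<gamma> this]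
  obtain X U where X0: "X 0 = f"
    and traj: "price_trajectory n k \<gamma> X U (\<lambda>s. max_price p ((discrete_step \<gamma> p ^^ s) B))"
    by blast
  define s where "s = nat \<lfloor>t / \<gamma>\<rfloor>"
  define q where "q = discrete_max_price \<gamma> p B t"
  have q: "q = max_price p ((discrete_step \<gamma> p ^^ s) B)"
    by (simp add: q_def discrete_max_price_def discrete_evolution_def s_def)
  have "real s = of_int \<lfloor>t / \<gamma>\<rfloor>"
    using assms(8) \<gamma> by (simp add: s_def)
  then have "real s \<le> t / \<gamma>" "t / \<gamma> < real (Suc s)"
    using floor_correct[of "t / \<gamma>"] unfolding of_nat_Suc by linarith+
  then have t: "real s * \<gamma> \<le> t" "t < real (Suc s) * \<gamma>"
    using \<gamma> by (simp_all only: pos_le_divide_eq pos_divide_less_eq)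
  define L where "L = {i. i < n \<and> f i < q - t}"
  define M where "M = {i. i < n \<and> f i \<in> {q - t..q + t}}"
  define E where "E = (\<Sum>i\<in>M. q - f i) + t * (2 * real (card L) + real (card M) - 2 * real k)"
  have M0: "card M > 0" and E: "\<bar>E\<bar> \<le> 2 * \<gamma> * real (card M)"
    using price_trajectory.window_bound[OF traj t] unfolding X0 E_def L_def M_def q by simp_all
  have n0: "n > 0" using k1 kn by simp
  have Mn: "card M \<le> n"
    using card_mono[of "{..<n}" M] by (auto simp: M_def)
  have G: "window_integral B t q - 2 * p * t = E / real n"
    using window_integral_labelled[OF assms(8), of f n q] n0 k
    unfolding B E_def L_def[symmetric] M_def[symmetric] by (simp add: field_simps)
  have mean: "window_mean B (q - t) (q + t) = (\<Sum>i\<in>M. f i) / real (card M)"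
  proof -
    have "{i \<in> {..<n}. f i \<in> {q - t..q + t}} = M" by (auto simp: M_def)
    then show ?thesis
      by (simp add: window_mean_def B filter_mset_image_mset sum_unfold_sum_mset del: atLeastAtMost_iff)
  qed
  have F_left: "left_limit (distr_fun B) (q - t) = real (card L) / real n"
    unfolding B L_def by (rule left_limit_distr_fun_labelled)
  have "{i. i < n \<and> f i \<le> q + t} = L \<union> M" and "L \<inter> M = {}" "finite L" "finite M"
    using assms(8) by (auto simp: L_def M_def)
  then have F_right: "distr_fun B (q + t) = (real (card L) + real (card M)) / real n"
    unfolding B distr_fun_labelled by (simp add: card_Un_disjoint)
  \<comment> \<open>In the quotient of distribution values the factor \<open>1 / real n\<close>
    cancels, leaving \<open>card M\<close> as the denominator.\<close>
  have "q - window_mean B (q - t) (q + t)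
      - (2 * p - left_limit (distr_fun B) (q - t) - distr_fun B (q + t))
        / (distr_fun B (q + t) - left_limit (distr_fun B) (q - t)) * t = E / real (card M)"
  proof -
    have num: "2 * p - left_limit (distr_fun B) (q - t) - distr_fun B (q + t)
        = (2 * real k - 2 * real (card L) - real (card M)) / real n"
      using n0 k unfolding F_left F_right by (simp add: field_simps)
    have den: "distr_fun B (q + t) - left_limit (distr_fun B) (q - t) = real (card M) / real n"
      unfolding F_left F_right by (simp add: add_divide_distrib)
    show ?thesis
      using M0 n0 unfolding mean E_def num den by (simp add: sum_subtractf field_simps)
  qed
  moreover have "\<bar>E / real (card M)\<bar> \<le> 2 * \<gamma>"
    using E M0 by (simp add: abs_divide pos_divide_le_eq)
  \<comment> \<open>The bound for \<open>E\<close> grows with \<open>card M\<close>, which is at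
    most \<open>n\<close>.\<close>
  moreover have "\<bar>E / real n\<bar> \<le> 2 * \<gamma>"
  proof -
    have "2 * \<gamma> * real (card M) \<le> 2 * \<gamma> * real n" using Mn \<gamma> by simp
    with E n0 show ?thesis by (simp add: abs_divide pos_divide_le_eq)
  qed
  ultimately show ?thesis
    unfolding Let_def q_def[symmetric] G by simp
qed

end
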